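(* Let $p$ be a prime, $m$ a positive integer, and $n$ an even positive integer divisible by $p^m$. Let $1\le k\le n-1$ with $k$ divisible by $p$. Then both $\mathcal{P}_{n-1,k-1}$ and $\mathcal{N}_{n-1,k-1}$ are divisible by $p^m$, where $\mathcal{P}_{n-1,k-1}$ is the number of parity alternating permutations of $[n-1]$ with exactly $k-1$ ascents and $\mathcal{N}_{n-1,k-1}$ is the number of permutations of $[n-1]$ with exactly $k-1$ ascents that are not parity alternating.
   Context: A permutation $a_1a_2\cdots a_N$ of $[N]=\{1,\dots,N\}$ (one-line notation) is parity alternating if $a_i$ and $a_{i+1}$ have different parities for every $1\le i\le N-1$. An ascent is an index $i$ ($1\le i\le N-1$) with $a_i<a_{i+1}$. *)

theory Defs
  imports "HOL-Combinatorics.Multiset_Permutations" "HOL-Computational_Algebra.Primes"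
begin

text \<open>
  A permutation $a_1 \ldots a_N$ of $[N]$ in one-line notation is a list in
  \<^term>\<open>permutations_of_set {1..N}\<close>. As list positions are counted from 0,
  $a_i$ is \<^term>\<open>a ! (i - 1)\<close>.
\<close>

definition parity_alternating :: "nat list \<Rightarrow> bool" where
  "parity_alternating a \<longleftrightarrow>
     (\<forall>i\<in>{1..<length a}. even (a ! (i - 1)) \<noteq> even (a ! i))"

definition ascents :: "nat list \<Rightarrow> nat set" where
  "ascents a = {i \<in> {1..<length a}. a ! (i - 1) < a ! i}"

definition num_parity_alternating :: "nat \<Rightarrow> nat \<Rightarrow> nat" where
  "num_parity_alternating N r =
     card {a \<in> permutations_of_set {1..N}. parity_alternating a \<and> card (ascents a) = r}"

definition num_not_parity_alternating :: "nat \<Rightarrow> nat \<Rightarrow> nat" where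
  "num_not_parity_alternating N r =
     card {a \<in> permutations_of_set {1..N}. \<not> parity_alternating a \<and> card (ascents a) = r}"

end

theory Submission
  imports Defs "HOL-Combinatorics.Cycles"
begin

text \<open>
  Read a permutation \<open>a\<close> of \<open>[n - 1]\<close> as the \<open>n\<close>-cycle \<open>g = (0 a\<^sub>1 \<dots> a\<^sub>n\<^sub>-\<^sub>1)\<close> on the residues modulo
  \<open>n\<close>, and let \<open>\<int>/n\<close> act by conjugation with the translation \<open>x \<mapsto> x + 1\<close>. The sum of the residues
  \<open>(g x - x) mod n\<close> is invariant and equals \<open>n\<close> times the number of cyclic descents, so the number of
  ascents is invariant. As \<open>n\<close> is even, so is the property that \<open>g\<close> flips parity, which
  characterizes parity alternating permutations. If \<open>p\<close> divides \<open>k\<close>, translation by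
  \<open>n / p\<close> fixes no cycle coming from a permutation with \<open>k - 1\<close> ascents, hence the subgroup of order
  \<open>p\<^sup>m\<close> acts freely.
\<close>

section \<open>Orbits of cyclic group actions\<close>

text \<open>With \<open>q = p ^ m\<close>, the power \<open>f ^^ (n div q)\<close> generates the
  action of a cyclic \<open>p\<close>-group. A nontrivial stabilizer would contain the subgroup of
  order \<open>p\<close>, generated by \<open>f ^^ (n div p)\<close>, which fixes no point of
  \<open>X\<close>. Hence all orbits have \<open>q\<close> elements.\<close>

lemma prime_power_dvd_card_of_cyclic_action:
  fixes f :: "'a \<Rightarrow> 'a" and p m n :: nat
  assumes "finite X" and "prime p" and "p ^ m dvd n" and "n > 0"
    and closed: "\<And>x. x \<in> X \<Longrightarrow> f x \<in> X"
    and period: "\<And>x. x \<in> X \<Longrightarrow> (f ^^ n) x = x"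
    and free: "\<And>x. x \<in> X \<Longrightarrow> (f ^^ (n div p)) x \<noteq> x"
  shows "p ^ m dvd card X"
proof (cases "m = 0")
  case False
  define q where "q = p ^ m"
  define g where "g = f ^^ (n div q)"
  have q: "q > 0" using \<open>prime p\<close> by (simp add: q_def prime_gt_0_nat)
  have pow: "g ^^ i = f ^^ (n div q * i)" for i
    by (simp add: g_def funpow_mult mult.commute)
  have g_closed: "(g ^^ i) x \<in> X" if "x \<in> X" for x i
  proof -
    have "(f ^^ j) x \<in> X" for j using that by (induction j) (auto intro: closed)
    then show ?thesis by (simp add: pow)
  qed
  have nq: "n div q * q = n" using assms(3) by (simp add: q_def)
  have g_period: "(g ^^ q) x = x" if "x \<in> X" for x
    using period[OF that] by (simp add: pow nq)
  have g_period': "(g ^^ (q * i)) x = x" if "x \<in> X" for x i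
    using g_period[OF that] by (induction i) (auto simp: funpow_add add.commute)
  have order: "q dvd i" if "x \<in> X" "(g ^^ i) x = x" for x i
  proof -
    have "least_power g x dvd p ^ m"
      using least_power_minimal[OF g_period[OF that(1)]] by (simp add: q_def)
    then obtain j where j: "j \<le> m" "least_power g x = p ^ j"
      using divides_primepow_nat[OF \<open>prime p\<close>] by blast
    have "j = m"
    proof (rule ccontr)
      assume "j \<noteq> m"
      then have "p ^ j dvd p ^ (m - 1)" using j by (intro le_imp_power_dvd) auto
      then obtain c where c: "p ^ (m - 1) = p ^ j * c" by blast
      have lp: "(g ^^ p ^ j) x = x"
        using least_powerI(1)[OF g_period[OF that(1)] q] j by simp
      have "(g ^^ (p ^ j * c)) x = x"
        using lp by (induction c) (auto simp: funpow_add add.commute)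
      moreover have "n div q * p ^ (m - 1) = n div p"
      proof -
        have "n = n div q * p ^ (m - 1) * p"
          using nq False by (cases m) (simp_all add: q_def mult_ac)
        then show ?thesis
          using \<open>prime p\<close> by (metis nonzero_mult_div_cancel_right not_prime_0)
      qed
      ultimately have "(f ^^ (n div p)) x = x" by (simp add: pow flip: c)
      with free[OF that(1)] show False by simp
    qed
    then show ?thesis using least_power_minimal[OF that(2)] j by (simp add: q_def)
  qed
  define R where "R = {(x, y). x \<in> X \<and> (\<exists>i. y = (g ^^ i) x)}"
  have "equiv X R"
  proof (rule equivI)
    show "R \<subseteq> X \<times> X" by (auto simp: R_def g_closed)
    show "refl_on X R" by (auto simp: refl_on_def R_def intro: exI[of _ 0])
    show "sym R"
    proof (rule symI)
      fix x y assume "(x, y) \<in> R"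
      then obtain i where i: "x \<in> X" "y = (g ^^ i) x" by (auto simp: R_def)
      \<comment> \<open>Since \<open>g ^^ q\<close> fixes every point of \<open>X\<close>,
        \<open>g ^^ (i * (q - 1))\<close> undoes \<open>g ^^ i\<close>.\<close>
      have "i * (q - 1) + i = q * i" using q by (cases q) auto
      then have "(g ^^ (i * (q - 1))) y = x"
        using g_period'[OF i(1), of i] by (simp add: i(2) flip: funpow_add comp_apply[of "g ^^ _"])
      then show "(y, x) \<in> R" using i(1) g_closed[OF i(1)] by (simp add: R_def i(2)) metis
    qed
    show "trans R"
      by (rule transI) (auto simp: R_def simp flip: funpow_add comp_apply[of "g ^^ _"])
  qed
  moreover have "q dvd card C" if "C \<in> X // R" for C
  proof -
    from that obtain x where x: "x \<in> X" "C = R `` {x}" by (auto elim: quotientE)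
    have "C = (\<lambda>i. (g ^^ i) x) ` {..<q}"
    proof (intro equalityI subsetI)
      fix y assume "y \<in> C"
      then obtain i where "y = (g ^^ i) x" by (auto simp: x R_def)
      also have "i = i mod q + q * (i div q)" by simp
      also have "(g ^^ \<dots>) x = (g ^^ (i mod q)) x"
        using g_period'[OF x(1)] by (simp only: funpow_add comp_apply)
      finally show "y \<in> (\<lambda>i. (g ^^ i) x) ` {..<q}" using q by auto
    qed (auto simp: x R_def)
    moreover have "inj_on (\<lambda>i. (g ^^ i) x) {..<q}"
    proof (rule linorder_inj_onI')
      fix i j assume ij: "i \<in> {..<q}" "j \<in> {..<q}" "i < j"
      show "(g ^^ i) x \<noteq> (g ^^ j) x"
      proof
        assume "(g ^^ i) x = (g ^^ j) x"
        then have "(g ^^ (q - i)) ((g ^^ i) x) = (g ^^ (q - i)) ((g ^^ j) x)" by simp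
        then have "x = (g ^^ (q - i + j)) x"
          using ij g_period[OF x(1)] by (simp flip: funpow_add comp_apply[of "g ^^ _"])
        then have "q dvd q - i + j" using order[OF x(1)] by metis
        moreover have "q - i + j = q + (j - i)" using ij by auto
        ultimately have "q dvd j - i" by (metis dvd_add_right_iff dvd_refl)
        then show False using ij dvd_imp_le[of q "j - i"] by auto
      qed
    qed
    ultimately show ?thesis by (simp add: card_image)
  qed
  ultimately have "q dvd card X" by (rule equiv_imp_dvd_card[OF \<open>finite X\<close>])
  then show ?thesis by (simp add: q_def)
qed simp

section \<open>Conjugation by the translation of residues\<close>

text \<open>Extension by the identity from \<open>n\<close> on gives a bijection of all naturals, so
  that \<open>inv\<close> and \<open>permutes\<close> apply.\<close>

definition cyclic_shift :: "nat \<Rightarrow> nat \<Rightarrow> nat" where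
  "cyclic_shift n x = (if x < n then (x + 1) mod n else x)"

lemma funpow_cyclic_shift:
  "(cyclic_shift n ^^ j) x = (if x < n then (x + j) mod n else x)"
  by (induction j) (auto simp: cyclic_shift_def mod_Suc_eq)

lemma funpow_cyclic_shift_eq_id: "cyclic_shift n ^^ n = id"
  by (auto simp: fun_eq_iff funpow_cyclic_shift)

lemma bij_cyclic_shift: "bij (cyclic_shift n)"
proof (cases n)
  case 0
  then have "cyclic_shift n = id" by (auto simp: fun_eq_iff cyclic_shift_def)
  then show ?thesis by simp
next
  case (Suc k)
  then show ?thesis
    using funpow_cyclic_shift_eq_id[of n]
    by (intro o_bij[of "cyclic_shift n ^^ k"]) (use Suc in \<open>simp_all add: fun_eq_iff funpow_swap1\<close>)
qed

lemma cyclic_shift_permutes: "cyclic_shift n permutes {..<n}"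
  using bij_cyclic_shift[of n] by (auto simp: bij_iff permutes_def cyclic_shift_def)

definition shift_conj :: "nat \<Rightarrow> (nat \<Rightarrow> nat) \<Rightarrow> nat \<Rightarrow> nat" where
  "shift_conj n g = cyclic_shift n \<circ> g \<circ> inv (cyclic_shift n)"

lemma shift_conj_apply: "shift_conj n g (cyclic_shift n x) = cyclic_shift n (g x)"
  using bij_cyclic_shift[of n] by (simp add: shift_conj_def bij_is_inj)

lemma funpow_shift_conj_apply:
  "(shift_conj n ^^ j) g ((cyclic_shift n ^^ j) x) = (cyclic_shift n ^^ j) (g x)"
  by (induction j) (simp_all add: shift_conj_apply)

lemma funpow_shift_conj_eq: "(shift_conj n ^^ n) g = g"
  using funpow_shift_conj_apply[of n n g] by (simp add: funpow_cyclic_shift_eq_id fun_eq_iff)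

section \<open>Cycles of length \<open>n\<close> and permutations of \<open>[n - 1]\<close>\<close>

definition full_cycles :: "nat \<Rightarrow> (nat \<Rightarrow> nat) set" where
  "full_cycles n = cycle_of_list ` permutations_of_set {..<n}"

lemma shift_conj_full_cycle:
  assumes "g \<in> full_cycles n"
  shows "shift_conj n g \<in> full_cycles n"
proof -
  from assms obtain L where L: "distinct L" "set L = {..<n}" "g = cycle_of_list L"
    by (auto simp: full_cycles_def permutations_of_set_def)
  then have "shift_conj n g = cycle_of_list (map (cyclic_shift n) L)"
    by (simp add: shift_conj_def conjugation_of_cycle bij_cyclic_shift)
  moreover have "map (cyclic_shift n) L \<in> permutations_of_set {..<n}"
    using L permutes_image[OF cyclic_shift_permutes[of n]]
      inj_on_subset[OF bij_is_inj[OF bij_cyclic_shift] subset_UNIV]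
    by (simp add: permutations_of_set_def distinct_map)
  ultimately show ?thesis by (simp add: full_cycles_def)
qed

lemma funpow_cycle_of_list_nth:
  assumes "distinct L" and "i < length L"
  shows "(cycle_of_list L ^^ j) (L ! i) = L ! ((j + i) mod length L)"
proof -
  have "(cycle_of_list L ^^ j) (L ! i) = map (cycle_of_list L ^^ j) L ! i"
    using assms by simp
  also have "\<dots> = rotate j L ! i" by (simp only: cyclic_rotation[OF assms(1)])
  also have "\<dots> = L ! ((j + i) mod length L)" using assms by (simp add: nth_rotate)
  finally show ?thesis .
qed

lemma cycle_of_list_nth:
  assumes "distinct L" and "i < length L"
  shows "cycle_of_list L (L ! i) = L ! (Suc i mod length L)"
  using funpow_cycle_of_list_nth[OF assms, of 1] by simp

text \<open>An \<open>n\<close>-cycle has exactly one listing that begins with 0: some rotation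
  brings 0 to the front, and the iterates of the cycle at 0 then determine all entries.\<close>

lemma bij_betw_cycle_of_list_Cons_0:
  assumes "n > 0"
  shows "bij_betw (\<lambda>a. cycle_of_list (0 # a)) (permutations_of_set {1..n - 1}) (full_cycles n)"
proof (rule bij_betw_imageI)
  have set: "insert 0 {1..n - 1} = {..<n}" using assms by auto
  show "inj_on (\<lambda>a. cycle_of_list (0 # a)) (permutations_of_set {1..n - 1})"
  proof (rule inj_onI)
    fix a b
    assume a: "a \<in> permutations_of_set {1..n - 1}" and b: "b \<in> permutations_of_set {1..n - 1}"
      and eq: "cycle_of_list (0 # a) = cycle_of_list (0 # b)"
    from a b have len: "length a = n - 1" "length b = n - 1"
      by (simp_all add: length_finite_permutations_of_set)
    have d: "distinct (0 # a)" "distinct (0 # b)" using a b by (auto simp: permutations_of_set_def)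
    have "(0 # a) ! j = (0 # b) ! j" if "j < n" for j
      using funpow_cycle_of_list_nth[OF d(1), of 0 j] funpow_cycle_of_list_nth[OF d(2), of 0 j] that
      by (simp add: len eq)
    then have "0 # a = 0 # b" using len assms by (intro nth_equalityI) auto
    then show "a = b" by simp
  qed
  show "(\<lambda>a. cycle_of_list (0 # a)) ` permutations_of_set {1..n - 1} = full_cycles n"
  proof (intro equalityI subsetI)
    fix g assume "g \<in> (\<lambda>a. cycle_of_list (0 # a)) ` permutations_of_set {1..n - 1}"
    then obtain a where "a \<in> permutations_of_set {1..n - 1}" "g = cycle_of_list (0 # a)" by auto
    moreover from this have "0 # a \<in> permutations_of_set {..<n}"
      using set by (auto simp: permutations_of_set_def)
    ultimately show "g \<in> full_cycles n" by (auto simp: full_cycles_def)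
  next
    fix g assume "g \<in> full_cycles n"
    then obtain L where L: "distinct L" "set L = {..<n}" "g = cycle_of_list L"
      by (auto simp: full_cycles_def permutations_of_set_def)
    then obtain i where i: "i < length L" "L ! i = 0"
      using assms by (metis in_set_conv_nth lessThan_iff)
    define a where "a = tl (rotate i L)"
    have "rotate i L \<noteq> []" using i by auto
    moreover have "hd (rotate i L) = 0" using i by (subst hd_rotate_conv_nth) auto
    ultimately have rot: "rotate i L = 0 # a" by (metis a_def list.collapse)
    then have da: "distinct (0 # a)" "set (0 # a) = {..<n}"
      using L by (metis distinct_rotate, metis set_rotate)
    have "set a = set (0 # a) - {0}" using da(1) by auto
    also have "\<dots> = {1..n - 1}" unfolding da(2) by auto
    finally have "set a = {1..n - 1}" .
    then have "a \<in> permutations_of_set {1..n - 1}" using da by (simp add: permutations_of_set_def)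
    moreover have "g = cycle_of_list (0 # a)"
      using cycle_of_list_rotate_independent[OF L(1), of i] L(3) rot by simp
    ultimately show "g \<in> (\<lambda>a. cycle_of_list (0 # a)) ` permutations_of_set {1..n - 1}" by blast
  qed
qed

lemma finite_full_cycles: "finite (full_cycles n)"
  by (simp add: full_cycles_def)

lemma full_cycle_permutes:
  assumes "g \<in> full_cycles n"
  shows "g permutes {..<n}"
proof -
  from assms obtain L where "set L = {..<n}" "g = cycle_of_list L"
    by (auto simp: full_cycles_def permutations_of_set_def)
  then show ?thesis using cycle_permutes[of L] by simp
qed

lemma permutes_lessThan_less:
  fixes x :: nat
  assumes "g permutes {..<n}" and "x < n"
  shows "g x < n"
  using permutes_in_image[OF assms(1), of x] assms(2) by simp

lemma Cons_0_permutation: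
  assumes "n > 0" and "a \<in> permutations_of_set {1..n - 1}"
  shows "distinct (0 # a)" and "set (0 # a) = {..<n}" and "length (0 # a) = n"
proof -
  show "distinct (0 # a)" using assms by (auto simp: permutations_of_set_def)
  show "set (0 # a) = {..<n}" using assms by (auto simp: permutations_of_set_def)
  show "length (0 # a) = n" using assms by (simp add: length_finite_permutations_of_set)
qed

lemma sum_over_cycle:
  assumes "distinct L" and "set L = {..<n}"
  shows "(\<Sum>x<n. F x (cycle_of_list L x)) = (\<Sum>i<n. F (L ! i) (L ! (Suc i mod n)))"
proof -
  have len: "length L = n" using distinct_card[OF assms(1)] assms(2) by simp
  have "bij_betw ((!) L) {..<n} {..<n}"
    by (rule bij_betw_nth) (simp_all add: assms len)
  then have "(\<Sum>x<n. F x (cycle_of_list L x)) = (\<Sum>i<n. F (L ! i) (cycle_of_list L (L ! i)))"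
    by (rule sum.reindex_bij_betw[symmetric])
  also have "\<dots> = (\<Sum>i<n. F (L ! i) (L ! (Suc i mod n)))"
    using cycle_of_list_nth[OF assms(1)] len by (intro sum.cong) auto
  finally show ?thesis .
qed

section \<open>Displacement, cyclic descents and ascents\<close>

definition displacement :: "nat \<Rightarrow> (nat \<Rightarrow> nat) \<Rightarrow> int" where
  "displacement n g = (\<Sum>x<n. (int (g x) - int x) mod int n)"

text \<open>Conjugation replaces each pair of \<open>x\<close> and \<open>g x\<close> by its
  translate, which has the same difference modulo \<open>n\<close>.\<close>

lemma displacement_shift_conj:
  assumes "g permutes {..<n}"
  shows "displacement n (shift_conj n g) = displacement n g"
proof -
  have "displacement n (shift_conj n g) =
      (\<Sum>x<n. (int (shift_conj n g (cyclic_shift n x)) - int (cyclic_shift n x)) mod int n)"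
    unfolding displacement_def
    by (rule sum.reindex_bij_betw[symmetric]) (rule permutes_imp_bij[OF cyclic_shift_permutes])
  also have "\<dots> = displacement n g"
    unfolding displacement_def
  proof (rule sum.cong[OF refl])
    fix x assume "x \<in> {..<n}"
    then have "int (cyclic_shift n x) = (int x + 1) mod int n"
      and "int (cyclic_shift n (g x)) = (int (g x) + 1) mod int n"
      using permutes_lessThan_less[OF assms] by (auto simp: cyclic_shift_def zmod_int ac_simps)
    then show "(int (shift_conj n g (cyclic_shift n x)) - int (cyclic_shift n x)) mod int n =
        (int (g x) - int x) mod int n"
      by (simp add: shift_conj_apply mod_diff_eq)
  qed
  finally show ?thesis .
qed

text \<open>Reduction modulo \<open>n\<close> adds \<open>n\<close> to \<open>g x - x\<close>
  exactly when \<open>g x < x\<close>, and the unreduced differences sum to 0 because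
  \<open>g\<close> permutes the residues.\<close>

lemma displacement_eq_descents:
  assumes "g permutes {..<n}"
  shows "displacement n g = int n * int (card {x \<in> {..<n}. g x < x})"
proof -
  have "(int (g x) - int x) mod int n = int (g x) - int x + int n * of_bool (g x < x)"
    if "x < n" for x
  proof (cases "g x < x")
    case True
    have "(int (g x) - int x) mod int n = (int (g x) - int x + int n) mod int n" by simp
    also have "\<dots> = int (g x) - int x + int n"
      using True that by (intro mod_pos_pos_trivial) auto
    finally show ?thesis using True by simp
  next
    case False
    then show ?thesis
      using permutes_lessThan_less[OF assms that] by (simp add: mod_pos_pos_trivial)
  qed
  then have "displacement n g =
      (\<Sum>x<n. int (g x)) - (\<Sum>x<n. int x) + int n * (\<Sum>x<n. of_bool (g x < x))"
    by (simp add: displacement_def sum.distrib sum_subtractf sum_distrib_left)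
  also have "(\<Sum>x<n. int (g x)) = (\<Sum>x<n. int x)"
    by (rule sum.reindex_bij_betw[OF permutes_imp_bij[OF assms]])
  also have "(\<Sum>x<n. of_bool (g x < x)) = int (card {x \<in> {..<n}. g x < x})"
    by (simp add: Int_def)
  finally show ?thesis by simp
qed

text \<open>Around the cycle, the step from 0 to the first entry rises and the step from the last
  entry back to 0 falls. Each of the remaining \<open>n - 2\<close> steps is an ascent or a descent
  of \<open>a\<close>.\<close>

lemma card_descents_cycle:
  assumes "n \<ge> 2" and a: "a \<in> permutations_of_set {1..n - 1}"
  shows "card {x \<in> {..<n}. cycle_of_list (0 # a) x < x} + card (ascents a) = n - 1"
proof -
  define N where "N = n - 1"
  have N: "n = Suc N" "N \<ge> 1" using assms by (auto simp: N_def)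
  have L: "distinct (0 # a)" "set (0 # a) = {..<n}" "length a = N"
    using Cons_0_permutation[OF _ a] assms by (auto simp: N_def)
  have nz: "a ! i > 0" if "i < N" for i
    using that L by (metis distinct.simps(2) gr0I nth_mem)
  have "card {x \<in> {..<n}. cycle_of_list (0 # a) x < x} =
      (\<Sum>x<n. of_bool (cycle_of_list (0 # a) x < x))"
    by (simp add: Int_def)
  also have "\<dots> = (\<Sum>i<n. of_bool ((0 # a) ! (Suc i mod n) < (0 # a) ! i))"
    by (rule sum_over_cycle[OF L(1,2)])
  also have "\<dots> = (\<Sum>i<N. of_bool (a ! i < (0 # a) ! i)) + of_bool (0 < (0 # a) ! N)"
    by (simp add: N)
  also have "(0 # a) ! N = a ! (N - 1)" using N by (simp add: nth_Cons')
  also have "of_bool (0 < a ! (N - 1)) = (1::nat)" using nz[of "N - 1"] N by simp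
  \<comment> \<open>The term for \<open>i = 0\<close> vanishes, as nothing lies below the leading
    0.\<close>
  also have "(\<Sum>i<N. of_bool (a ! i < (0 # a) ! i)) = (\<Sum>i=1..<N. of_bool (a ! i < a ! (i - 1)) :: nat)"
    using N by (intro sum.mono_neutral_cong_right) (auto simp: nth_Cons')
  finally have des: "card {x \<in> {..<n}. cycle_of_list (0 # a) x < x} =
      (\<Sum>i=1..<N. of_bool (a ! i < a ! (i - 1))) + 1" .
  have asc: "card (ascents a) = (\<Sum>i=1..<N. of_bool (a ! (i - 1) < a ! i))"
    by (simp add: ascents_def L Int_def)
  have "card {x \<in> {..<n}. cycle_of_list (0 # a) x < x} + card (ascents a) =
      (\<Sum>i=1..<N. of_bool (a ! i < a ! (i - 1)) + of_bool (a ! (i - 1) < a ! i)) + 1"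
    by (simp only: des asc sum.distrib ac_simps)
  also have "\<dots> = (\<Sum>i=1..<N. 1) + 1"
  proof (intro arg_cong2[where f = "(+)"] sum.cong refl)
    fix i assume "i \<in> {1..<N}"
    then have "a ! i \<noteq> a ! (i - 1)" using L(1,3) by (auto simp: nth_eq_iff_index_eq)
    then show "of_bool (a ! i < a ! (i - 1)) + of_bool (a ! (i - 1) < a ! i) = (1::nat)" by auto
  qed
  also have "\<dots> = n - 1" using N by simp
  finally show ?thesis .
qed

section \<open>Parity along the cycle\<close>

definition parity_flipping :: "nat \<Rightarrow> (nat \<Rightarrow> nat) \<Rightarrow> bool" where
  "parity_flipping n g \<longleftrightarrow> (\<forall>x<n. even x \<noteq> even (g x))"

text \<open>For even \<open>n\<close> the translation flips the parity of every residue, even at the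
  wraparound from \<open>n - 1\<close> to 0, so it preserves whether two residues differ in
  parity.\<close>

lemma parity_flipping_shift_conj:
  assumes "even n" and g: "g permutes {..<n}"
  shows "parity_flipping n (shift_conj n g) \<longleftrightarrow> parity_flipping n g"
proof -
  have flip: "even (cyclic_shift n x) \<noteq> even x" if "x < n" for x
    using that \<open>even n\<close> by (simp add: cyclic_shift_def dvd_mod_iff)
  have "parity_flipping n (shift_conj n g) \<longleftrightarrow>
      (\<forall>x\<in>cyclic_shift n ` {..<n}. even x \<noteq> even (shift_conj n g x))"
    by (simp only: permutes_image[OF cyclic_shift_permutes] parity_flipping_def Ball_def lessThan_iff)
  also have "\<dots> \<longleftrightarrow> parity_flipping n g"
    using flip permutes_lessThan_less[OF g] by (auto simp: shift_conj_apply parity_flipping_def)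
  finally show ?thesis .
qed

text \<open>
  A parity alternating \<open>a\<close> satisfies \<open>a ! i \<equiv> i + a ! 0 (mod 2)\<close>; summing over all positions
  and comparing with the sum of \<open>[N]\<close> determines the parity of the first entry.
\<close>

lemma odd_hd_parity_alternating:
  assumes "odd N" and a: "a \<in> permutations_of_set {1..N}" and alt: "parity_alternating a"
  shows "odd (a ! 0)" and "odd (a ! (N - 1))"
proof -
  have len: "length a = N" using a by (simp add: length_finite_permutations_of_set)
  have par: "even (a ! i + i + a ! 0)" if "i < N" for i
    using that
  proof (induction i)
    case (Suc i)
    then have "even (a ! i) \<noteq> even (a ! Suc i)"
      using alt len unfolding parity_alternating_def by (auto dest!: bspec[of _ _ "Suc i"])
    with Suc show ?case by auto
  qed simp
  have "bij_betw ((!) a) {..<N} {1..N}"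
    using a len by (intro bij_betw_nth) (auto simp: permutations_of_set_def)
  then have "(\<Sum>i<N. a ! i) = (\<Sum>x=1..N. x)" by (rule sum.reindex_bij_betw)
  also have "\<dots> = (\<Sum>i<N. i + 1)" by (simp add: sum.atLeast1_atMost_eq)
  \<comment> \<open>The two added ones keep each summand even and turn the middle terms into a
    second copy of the sum over \<open>[N]\<close>, which leaves \<open>N * (a ! 0 + 1)\<close>
    modulo 2.\<close>
  finally have "(\<Sum>i<N. a ! i + (i + 1) + (a ! 0 + 1)) = 2 * (\<Sum>i<N. i + 1) + N * (a ! 0 + 1)"
    by (simp only: sum.distrib[of _ "\<lambda>_. a ! 0 + 1"] sum.distrib[of "(!) a"]) simp
  moreover have "even (\<Sum>i<N. a ! i + (i + 1) + (a ! 0 + 1))" using par by (intro dvd_sum) auto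
  ultimately have "even (N * (a ! 0 + 1))" by simp
  then show "odd (a ! 0)" using \<open>odd N\<close> by simp
  then show "odd (a ! (N - 1))" using par[of "N - 1"] \<open>odd N\<close> by (cases N) auto
qed

text \<open>Steps between entries of \<open>a\<close> express alternation itself. The two steps
  through 0 require odd end entries, which alternation forces because \<open>n - 1\<close> is
  odd.\<close>

lemma parity_flipping_cycle_iff:
  assumes "n > 0" and "even n" and a: "a \<in> permutations_of_set {1..n - 1}"
  shows "parity_flipping n (cycle_of_list (0 # a)) \<longleftrightarrow> parity_alternating a"
proof -
  have odd: "odd (n - 1)" using assms by simp
  then have n: "n - 1 \<ge> 1" by (cases "n - 1") auto
  have L: "distinct (0 # a)" "set (0 # a) = {..<n}" "length (0 # a) = n"
    using Cons_0_permutation[OF \<open>n > 0\<close> a] by auto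
  have "parity_flipping n (cycle_of_list (0 # a)) \<longleftrightarrow>
      (\<forall>x\<in>set (0 # a). even x \<noteq> even (cycle_of_list (0 # a) x))"
    by (simp only: parity_flipping_def L(2) Ball_def lessThan_iff)
  also have "\<dots> \<longleftrightarrow> (\<forall>i<n. even ((0 # a) ! i) \<noteq> even ((0 # a) ! (Suc i mod n)))"
    using cycle_of_list_nth[OF L(1)] L(3) by (metis in_set_conv_nth)
  also have "\<dots> \<longleftrightarrow> parity_alternating a"
  proof
    assume *: "\<forall>i<n. even ((0 # a) ! i) \<noteq> even ((0 # a) ! (Suc i mod n))"
    show "parity_alternating a"
      unfolding parity_alternating_def
    proof
      fix i assume "i \<in> {1..<length a}"
      then show "even (a ! (i - 1)) \<noteq> even (a ! i)"
        using *[rule_format, of i] L(3) by (auto simp: nth_Cons')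
    qed
  next
    assume alt: "parity_alternating a"
    show "\<forall>i<n. even ((0 # a) ! i) \<noteq> even ((0 # a) ! (Suc i mod n))"
    proof (intro allI impI)
      fix i assume i: "i < n"
      consider "i = 0" | "i = n - 1" | "1 \<le> i" "i < n - 1" using i by linarith
      then show "even ((0 # a) ! i) \<noteq> even ((0 # a) ! (Suc i mod n))"
      proof cases
        case 1
        then show ?thesis using odd_hd_parity_alternating[OF odd a alt] n by simp
      next
        case 2
        then have "Suc i mod n = 0" using n by simp
        then show ?thesis using odd_hd_parity_alternating[OF odd a alt] n 2 by (simp add: nth_Cons')
      next
        case 3
        then have "even (a ! (i - 1)) \<noteq> even (a ! i)"
          using alt L(3) by (auto simp: parity_alternating_def)
        then show ?thesis using 3 by (simp add: nth_Cons')
      qed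
    qed
  qed
  finally show ?thesis .
qed

section \<open>Freeness of the action of the subgroup of order \<open>p\<close>\<close>

lemma sum_periodic:
  fixes w :: "nat \<Rightarrow> 'a::comm_semiring_1"
  assumes "\<And>i. w (r + i) = w i"
  shows "(\<Sum>i<t * r. w i) = of_nat t * (\<Sum>i<r. w i)"
proof (induction t)
  case (Suc t)
  have "(\<Sum>i<r + s. w i) = (\<Sum>i<r. w i) + (\<Sum>i<s. w (r + i))" for s
    by (induction s) (simp_all add: add.assoc)
  from this[of "t * r", unfolded assms] Suc show ?case by (simp add: algebra_simps)
qed simp

text \<open>
  If conjugation by \<open>x \<mapsto> x + n / p\<close> fixes \<open>g\<close>, that translation agrees with a power \<open>g\<^sup>r\<close> on \<open>{..<n}\<close>,
  and \<open>n\<close> divides \<open>p r\<close>, say \<open>p r = u n\<close>. Summing \<open>(g x - x) mod n\<close> along \<open>p r\<close> steps of the orbit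
  of \<open>0\<close>, once as \<open>p\<close> blocks of length \<open>r\<close> and once as \<open>u\<close> full turns, gives
  \<open>p (n / p + n D) = u n (n - k)\<close>, so that \<open>1 + p D = u (n - k)\<close> would be divisible by \<open>p\<close>.
\<close>

lemma funpow_shift_conj_neq:
  fixes p n k :: nat
  assumes "prime p" and "p dvd n" and "p dvd k" and "n > 0" and g: "g \<in> full_cycles n"
    and disp: "displacement n g = int n * (int n - int k)"
  shows "(shift_conj n ^^ (n div p)) g \<noteq> g"
proof
  assume fixed: "(shift_conj n ^^ (n div p)) g = g"
  define h where "h = n div p"
  have hp: "h * p = n" using \<open>p dvd n\<close> by (simp add: h_def)
  have "h < n" using prime_gt_1_nat[OF \<open>prime p\<close>] \<open>n > 0\<close> by (simp add: h_def)
  from g obtain a where a: "a \<in> permutations_of_set {1..n - 1}" "g = cycle_of_list (0 # a)"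
    using bij_betw_cycle_of_list_Cons_0[OF \<open>n > 0\<close>] by (auto simp: bij_betw_def)
  note L = Cons_0_permutation[OF \<open>n > 0\<close> a(1)]
  define c where "c i = (g ^^ i) 0" for i
  have c_nth: "c i = (0 # a) ! (i mod n)" for i
    using funpow_cycle_of_list_nth[OF L(1), of 0 i] L(3) by (simp add: c_def a(2))
  have c_less: "c i < n" for i
    using L nth_mem[of "i mod n" "0 # a"] \<open>n > 0\<close> by (simp add: c_nth)
  have comm: "g ((cyclic_shift n ^^ h) x) = (cyclic_shift n ^^ h) (g x)" for x
    using funpow_shift_conj_apply[where n = n and j = h and g = g and x = x] fixed by (simp add: h_def)
  obtain r where r: "r < n" "(0 # a) ! r = h" using L \<open>h < n\<close> by (metis in_set_conv_nth lessThan_iff)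
  \<comment> \<open>The map \<open>g ^^ r\<close> and translation by \<open>h\<close> agree at 0;
    since \<open>g\<close> commutes with the translation, they agree along the whole orbit of
    0.\<close>
  have c_r: "c (r + i) = (c i + h) mod n" for i
  proof -
    have "(g ^^ r) 0 = (cyclic_shift n ^^ h) 0"
      using c_nth[of r] r \<open>h < n\<close> by (simp add: c_def funpow_cyclic_shift)
    then have "c (r + i) = (g ^^ i) ((cyclic_shift n ^^ h) 0)"
      by (simp add: c_def add.commute[of r] funpow_add)
    also have "\<dots> = (cyclic_shift n ^^ h) (c i)" by (induction i) (simp_all add: c_def comm)
    finally show ?thesis using c_less by (simp add: funpow_cyclic_shift)
  qed
  have "c (t * r) = (t * h) mod n" for t
  proof (induction t)
    case (Suc t)
    then show ?case using c_r[of "t * r"] by (simp add: mod_add_right_eq add.commute)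
  qed (simp add: c_def)
  \<comment> \<open>Translating \<open>p\<close> times by \<open>h = n / p\<close> returns to 0, and
    the orbit of 0 meets 0 only at multiples of \<open>n\<close>.\<close>
  from this[of p] have "c (p * r) = 0" using hp by (simp add: mult.commute)
  then have "p * r mod n = 0"
    using L \<open>n > 0\<close> nth_eq_iff_index_eq[OF L(1), of "p * r mod n" 0] by (simp add: c_nth)
  then obtain u where u: "p * r = u * n" by (metis mod_0_imp_dvd dvdE mult.commute)

  define w where "w i = (int (c (Suc i)) - int (c i)) mod int n" for i
  have w_r: "w (r + i) = w i" for i
  proof -
    have "w (r + i) = (int (c (r + Suc i)) - int (c (r + i))) mod int n" by (simp add: w_def)
    then show ?thesis by (simp only: c_r zmod_int mod_diff_eq) (simp add: w_def)
  qed
  have w_n: "w (n + i) = w i" for i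
    by (simp add: w_def c_nth flip: add_Suc_right)
  have "(\<Sum>i<n. w i) = displacement n g"
    using sum_over_cycle[OF L(1,2), of "\<lambda>x y. (int y - int x) mod int n"]
    by (simp add: w_def c_nth displacement_def a(2))
  then have turns: "(\<Sum>i<p * r. w i) = int u * (int n * (int n - int k))"
    using sum_periodic[of w n u, OF w_n] by (simp add: u disp)
  \<comment> \<open>Modulo \<open>n\<close> a block of length \<open>r\<close> telescopes from
    \<open>c 0 = 0\<close> to \<open>c r = h\<close>; \<open>D\<close> is the resulting
    quotient.\<close>
  have "(\<Sum>i<r. w i) mod int n = (\<Sum>i<r. int (c (Suc i)) - int (c i)) mod int n"
    unfolding w_def by (rule mod_sum_eq)
  also have "(\<Sum>i<r. int (c (Suc i)) - int (c i)) = int h"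
    using r c_nth[of 0] c_nth[of r] sum_lessThan_telescope[of "\<lambda>i. int (c i)" r] by simp
  finally have "int n dvd (\<Sum>i<r. w i) - int h" by (simp only: mod_eq_dvd_iff)
  then obtain D where "(\<Sum>i<r. w i) - int h = int n * D" by blast
  then have "(\<Sum>i<r. w i) = int h + int n * D" by simp
  then have "(\<Sum>i<p * r. w i) = int p * (int h + int n * D)"
    using sum_periodic[of w r p, OF w_r] by simp
  also have "\<dots> = int n * (1 + int p * D)"
    using hp by (simp add: algebra_simps flip: of_nat_mult)
  finally have "1 + int p * D = int u * (int n - int k)"
    using turns \<open>n > 0\<close> by (simp add: mult.left_commute)
  moreover have "int p dvd int u * (int n - int k)"
    using \<open>p dvd n\<close> \<open>p dvd k\<close> by simp
  ultimately have "int p dvd 1 + int p * D" by simp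
  then have "int p dvd 1" by (metis dvd_add_left_iff dvd_triv_left)
  then show False using \<open>prime p\<close> by (simp add: not_prime_unit)
qed

section \<open>Divisibility of the two counts\<close>

text \<open>Any conjugation-invariant property \<open>Q\<close> of cycles is allowed, so that parity
  flipping and its negation are treated alike.\<close>

lemma prime_power_dvd_card_invariant_permutations:
  fixes p m n k :: nat
  assumes "prime p" and "m \<ge> 1" and "p ^ m dvd n" and "1 \<le> k" and "k \<le> n - 1" and "p dvd k"
    and R: "\<And>a. a \<in> permutations_of_set {1..n - 1} \<Longrightarrow> R a \<longleftrightarrow> Q (cycle_of_list (0 # a))"
    and Q: "\<And>g. g permutes {..<n} \<Longrightarrow> Q g \<Longrightarrow> Q (shift_conj n g)"
  shows "p ^ m dvd card {a \<in> permutations_of_set {1..n - 1}. R a \<and> card (ascents a) = k - 1}"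
proof -
  have n: "n > 0" "n \<ge> 2" using assms(4,5) by auto
  have "p dvd n" using dvd_power[of m p] dvd_trans[OF _ assms(3)] assms(2) by auto
  \<comment> \<open>Having \<open>k - 1\<close> ascents means
    \<open>(n - 1) - (k - 1) = n - k\<close> cyclic descents, hence displacement
    \<open>n (n - k)\<close>.\<close>
  let ?X = "{g \<in> full_cycles n. Q g \<and> displacement n g = int n * (int n - int k)}"
  have "bij_betw (\<lambda>a. cycle_of_list (0 # a))
      {a \<in> permutations_of_set {1..n - 1}. R a \<and> card (ascents a) = k - 1} ?X"
  proof (rule bij_betw_Collect[OF bij_betw_cycle_of_list_Cons_0[OF n(1)]])
    fix a assume a: "a \<in> permutations_of_set {1..n - 1}"
    have "cycle_of_list (0 # a) permutes {..<n}"
      using cycle_permutes[of "0 # a"] Cons_0_permutation(2)[OF n(1) a] by simp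
    then show "(Q (cycle_of_list (0 # a)) \<and>
          displacement n (cycle_of_list (0 # a)) = int n * (int n - int k)) \<longleftrightarrow>
        (R a \<and> card (ascents a) = k - 1)"
      using card_descents_cycle[OF n(2) a] R[OF a] n assms(4,5)
      by (auto simp: displacement_eq_descents)
  qed
  moreover have "p ^ m dvd card ?X"
  proof (rule prime_power_dvd_card_of_cyclic_action[OF _ assms(1,3) n(1), of _ "shift_conj n"])
    show "finite ?X" by (simp add: finite_full_cycles)
    show "shift_conj n g \<in> ?X" if "g \<in> ?X" for g
      using that Q full_cycle_permutes by (auto simp: shift_conj_full_cycle displacement_shift_conj)
    show "(shift_conj n ^^ n) g = g" for g by (rule funpow_shift_conj_eq)
    show "(shift_conj n ^^ (n div p)) g \<noteq> g" if "g \<in> ?X" for g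
      using that funpow_shift_conj_neq[OF assms(1) \<open>p dvd n\<close> assms(6) n(1)] by auto
  qed
  ultimately show ?thesis by (simp add: bij_betw_same_card)
qed

theorem theorem5:
  fixes p m n k :: nat
  assumes "prime p"
    and "m \<ge> 1"
    and "n > 0"
    and "even n"
    and "p ^ m dvd n"
    and "1 \<le> k" and "k \<le> n - 1"
    and "p dvd k"
  shows "p ^ m dvd num_parity_alternating (n - 1) (k - 1) \<and>
         p ^ m dvd num_not_parity_alternating (n - 1) (k - 1)"
  unfolding num_parity_alternating_def num_not_parity_alternating_def
proof
  show "p ^ m dvd card {a \<in> permutations_of_set {1..n - 1}.
      parity_alternating a \<and> card (ascents a) = k - 1}"
    by (rule prime_power_dvd_card_invariant_permutations[where Q = "parity_flipping n"])
      (use assms in \<open>simp_all add: parity_flipping_cycle_iff parity_flipping_shift_conj\<close>)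
  show "p ^ m dvd card {a \<in> permutations_of_set {1..n - 1}.
      \<not> parity_alternating a \<and> card (ascents a) = k - 1}"
    by (rule prime_power_dvd_card_invariant_permutations[where Q = "\<lambda>g. \<not> parity_flipping n g"])
      (use assms in \<open>simp_all add: parity_flipping_cycle_iff parity_flipping_shift_conj\<close>)
qed

end
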